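(* Let $\mathcal{P}=(P,d\mu,d\sigma)$ be an $n$-dimensional system with $n\ge2$. For every $q\in[1,\frac{n}{n-1}]$ there exists a constant $C_{P,q}>0$ such that \[ \Big(\int_P u^q\,d\mu\Big)^{\frac1q}\le C_{P,q}\int_{\partial P}u\,d\sigma \] for every non-negative convex function $u:P\to[0,\infty]$.
   Context: An $n$-dimensional system is a triple $\mathcal{P}=(P,d\mu,d\sigma)$ where $P$ is a simple polytope in an $n$-dimensional real affine space $V$ (a compact subset with non-empty interior that is a finite intersection of closed half spaces, such that every vertex is the intersection of exactly $n$ facets), $d\mu$ is the restriction to $P$ of a translation-invariant measure on $V$ that is positive and finite on bounded non-empty open sets (i.e. a positive multiple of Lebesgue measure), and $d\sigma$ is a measure on the boundary $\partial P$ whose restriction to each facet is a positive multiple of the Lebesgue measure of the affine hyperplane spanned by that facet. *)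

theory Defs
  imports "HOL-Analysis.Analysis"
begin

definition simple_polytope :: "'a::euclidean_space set \<Rightarrow> bool" where
  "simple_polytope P \<longleftrightarrow> polyhedron P \<and> compact P \<and> interior P \<noteq> {} \<and>
     (\<forall>v. v extreme_point_of P \<longrightarrow> card {F. F facet_of P \<and> v \<in> F} = DIM('a))"

text \<open>Lebesgue measure of the affine hyperplane H = {x. a . x = b} (a nonzero),
evaluated on a set A contained in H.  It is computed as the n-dimensional Lebesgue
measure of the unit-thickness slab over A (the set of points whose orthogonal
projection to H lies in A and whose signed distance to H lies in [0,1]).\<close>
definition hyperplane_measure :: "'a::euclidean_space \<Rightarrow> real \<Rightarrow> 'a set \<Rightarrow> ennreal" where
  "hyperplane_measure a b A =
     emeasure lborel {x. (a \<bullet> x - b) / norm a \<in> {0..1} \<and>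
                        x - ((a \<bullet> x - b) / (norm a)\<^sup>2) *\<^sub>R a \<in> A}"

definition volume_measure_on :: "'a::euclidean_space set \<Rightarrow> 'a measure \<Rightarrow> bool" where
  "volume_measure_on P \<mu> \<longleftrightarrow> sets \<mu> = sets borel \<and>
     (\<exists>c::real. c > 0 \<and> (\<forall>A \<in> sets borel. emeasure \<mu> A = ennreal c * emeasure lborel (A \<inter> P)))"

definition boundary_measure_on :: "'a::euclidean_space set \<Rightarrow> 'a measure \<Rightarrow> bool" where
  "boundary_measure_on P \<sigma> \<longleftrightarrow> sets \<sigma> = sets borel \<and>
     emeasure \<sigma> (- frontier P) = 0 \<and>
     (\<forall>F. F facet_of P \<longrightarrow>
        (\<exists>a b c. a \<noteq> 0 \<and> affine hull F = {x. a \<bullet> x = b} \<and> c > (0::real) \<and>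
           (\<forall>A \<in> sets borel. A \<subseteq> F \<longrightarrow> emeasure \<sigma> A = ennreal c * hyperplane_measure a b A)))"

definition n_system :: "'a::euclidean_space set \<Rightarrow> 'a measure \<Rightarrow> 'a measure \<Rightarrow> bool" where
  "n_system P \<mu> \<sigma> \<longleftrightarrow> simple_polytope P \<and> volume_measure_on P \<mu> \<and> boundary_measure_on P \<sigma>"

definition convex_on_ennreal :: "'a::real_vector set \<Rightarrow> ('a \<Rightarrow> ennreal) \<Rightarrow> bool" where
  "convex_on_ennreal S u \<longleftrightarrow> (\<forall>x\<in>S. \<forall>y\<in>S. \<forall>t::real. 0 \<le> t \<and> t \<le> 1 \<longrightarrow>
      u ((1 - t) *\<^sub>R x + t *\<^sub>R y) \<le> ennreal (1 - t) * u x + ennreal t * u y)"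

text \<open>Real powers of [0,\<infinity>] values (for positive exponents): \<infinity>^r = \<infinity>.\<close>
definition enn_powr :: "ennreal \<Rightarrow> real \<Rightarrow> ennreal" where
  "enn_powr x r = (if x = \<infinity> then \<infinity> else ennreal (enn2real x powr r))"

end

(* The superlevel sets of u in P are complements P - K of convex sets K. A line through a point of
   the interior of P outside K avoids K on one of its two sides, so it meets the boundary of P
   outside K. Hence every coordinate projection of P - K is contained, up to a null set, in the
   projection of frontier P - K, and the Loomis-Whitney inequality gives
     vol (P - K) ^ (n - 1) \<le> (C * sigma (frontier P - K)) ^ n.
   Apply this at the levels J, 2 J, 4 J, ... with J \<ge> the boundary integral of u, and sum. The power
   n / (n - 1) of sigma {u > t} is absorbed by the Chebyshev bound t * sigma {u > t} \<le> J. *)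

theory Submission
  imports Defs
begin

text \<open>The measure \<sigma> is given facet by facet through \<open>hyperplane_measure\<close>,
  the volume of a unit slab in the normal direction. By Fubini, the shadow of a facet piece along a
  basis vector \<open>i\<close> has the volume of a unit slab in direction \<open>i\<close>. An
  affine bijection carries one slab to the other, so on each facet not parallel to \<open>i\<close>
  a constant compares shadow and \<sigma>. The inequality between volume and \<sigma> belongs to the
  critical exponent n / (n - 1); smaller \<open>q\<close> follow because \<open>P\<close> has finite
  volume. As \<open>u\<close> need not be Borel, a geometric sequence of levels is convenient: it
  involves only countably many sets, each replaced by a Borel one. Below the level \<open>J\<close>
  the integrand is at most \<open>J powr q\<close>; the higher levels also add up to a multiple of
  \<open>J powr q\<close>, so the q-th root is linear in \<open>J\<close>. An upper bound
  \<open>J\<close> stands in for the boundary integral because the levels must be positive and the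
  integral may be 0.\<close>

section \<open>A Loomis-Whitney inequality with a sum of shadows\<close>

lemma ennreal_power_le_imp_le:
  fixes x y :: ennreal
  assumes "x ^ n \<le> y ^ n" "n > 0"
  shows "x \<le> y"
proof (cases "y = top")
  case False
  with assms have "x \<noteq> top"
    by (metis power_eq_top_ennreal top.extremum_uniqueI not_gr_zero)
  then obtain a b where ab: "x = ennreal a" "y = ennreal b" "0 \<le> a" "0 \<le> b"
    using False by (metis ennreal_cases infinity_ennreal_def)
  then have "a ^ n \<le> b ^ n"
    using assms by (simp add: ennreal_power)
  then show ?thesis
    using ab assms(2) by (simp add: power_mono_iff)
qed simp

text \<open>The classical right-hand side is the product of the shadow measures; the power of their
  sum dominates it and is easier to carry through an induction that slices \<open>S\<close> along
  one coordinate. Positivity matters for a single coordinate: there the left side is a zeroth power,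
  hence 1, and \<open>S\<close> must be nonempty to force its shadow to be the whole one-point space
  of measure 1.\<close>

lemma (in product_sigma_finite) weak_Loomis_Whitney:
  assumes "finite I" "I \<noteq> {}"
    and "S \<in> sets (PiM I M)"
    and "\<And>i. i \<in> I \<Longrightarrow> T i \<in> sets (PiM (I - {i}) M)"
    and "\<And>x i. x \<in> S \<Longrightarrow> i \<in> I \<Longrightarrow> restrict x (I - {i}) \<in> T i"
    and "emeasure (PiM I M) S > 0"
  shows "emeasure (PiM I M) S ^ (card I - 1) \<le> (\<Sum>i\<in>I. emeasure (PiM (I - {i}) M) (T i)) ^ card I"
  using assms
proof (induction I arbitrary: S T rule: finite_ne_induct)
  case (singleton i)
  then have "S \<noteq> {}" by auto
  then obtain x where "x \<in> S" by auto
  then have "restrict x {} \<in> T i" using singleton(3)[of x i] by (simp add: restrict_def)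
  moreover have "T i \<in> sets (PiM {} M)" using singleton(2)[of i] by simp
  ultimately have "T i = {\<lambda>_. undefined}" by (auto simp: sets_PiM_empty)
  then show ?case by simp
next
  case (insert j I)
  note jI = \<open>finite I\<close> \<open>j \<notin> I\<close>
  note [measurable] = insert.prems(1)
  have eqD: "insert j I - {i} = insert j (I - {i})" if "i \<in> I" for i using jI that by auto
  have eqj: "insert j I - {j} = I" using jI by auto
  have T'[measurable]: "T i \<in> sets (PiM (insert j (I - {i})) M)" if "i \<in> I" for i
    using insert.prems(2)[of i] that eqD by auto
  have Tj[measurable]: "T j \<in> sets (PiM I M)"
    using insert.prems(2)[of j] eqj by auto
  define n where "n = card I"
  have n: "n > 0" using insert by (auto simp: n_def card_gt_0_iff)
  define S' where "S' t = {x \<in> space (PiM I M). x(j := t) \<in> S}" for t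
  define T'' where "T'' t i = {x \<in> space (PiM (I - {i}) M). x(j := t) \<in> T i}" for t i
  define m where "m = emeasure (PiM I M) (T j)"
  define g where "g t = (\<Sum>i\<in>I. emeasure (PiM (I - {i}) M) (T'' t i))" for t
  have upd: "(\<lambda>x. x(j := t)) \<in> measurable (PiM J M) (PiM (insert j J) M)" if "t \<in> space (M j)" for t J
    using that by (intro measurable_fun_upd[where J=J]) auto
  have S'm: "S' t \<in> sets (PiM I M)" if "t \<in> space (M j)" for t
    using measurable_sets[OF upd[OF that, of I] insert.prems(1)]
    by (simp add: S'_def vimage_def Int_def conj_commute)
  have T''m: "T'' t i \<in> sets (PiM (I - {i}) M)" if "t \<in> space (M j)" "i \<in> I" for t i
    using measurable_sets[OF upd[OF that(1), of "I - {i}"] T'[OF that(2)]]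
    by (simp add: T''_def vimage_def Int_def conj_commute)
  have S: "emeasure (PiM (insert j I) M) S = (\<integral>\<^sup>+ t. emeasure (PiM I M) (S' t) \<partial>M j)"
  proof -
    have "emeasure (PiM (insert j I) M) S = (\<integral>\<^sup>+ x. indicator S x \<partial>PiM (insert j I) M)"
      using insert.prems(1) by simp
    also have "\<dots> = (\<integral>\<^sup>+ t. (\<integral>\<^sup>+ x. indicator S (x(j := t)) \<partial>PiM I M) \<partial>M j)"
      using jI by (intro product_nn_integral_insert_rev) auto
    also have "\<dots> = (\<integral>\<^sup>+ t. (\<integral>\<^sup>+ x. indicator (S' t) x \<partial>PiM I M) \<partial>M j)"
      by (intro nn_integral_cong) (auto simp: S'_def indicator_def)
    also have "\<dots> = (\<integral>\<^sup>+ t. emeasure (PiM I M) (S' t) \<partial>M j)"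
      by (intro nn_integral_cong) (simp add: S'm)
    finally show ?thesis .
  qed
  have T: "emeasure (PiM (insert j I - {i}) M) (T i) = (\<integral>\<^sup>+ t. emeasure (PiM (I - {i}) M) (T'' t i) \<partial>M j)"
    and Tm: "(\<lambda>t. emeasure (PiM (I - {i}) M) (T'' t i)) \<in> borel_measurable (M j)" if i: "i \<in> I" for i
  proof -
    interpret J: finite_product_sigma_finite M "I - {i}" using jI by unfold_locales auto
    have *: "(\<lambda>t. \<integral>\<^sup>+ x. indicator (T i) (x(j := t)) \<partial>PiM (I - {i}) M) \<in> borel_measurable (M j)"
      using T'[OF i] jI by measurable
    have **: "(\<integral>\<^sup>+ x. indicator (T i) (x(j := t)) \<partial>PiM (I - {i}) M) = emeasure (PiM (I - {i}) M) (T'' t i)"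
      if "t \<in> space (M j)" for t
    proof -
      have "(\<integral>\<^sup>+ x. indicator (T i) (x(j := t)) \<partial>PiM (I - {i}) M) = (\<integral>\<^sup>+ x. indicator (T'' t i) x \<partial>PiM (I - {i}) M)"
        by (intro nn_integral_cong) (auto simp: T''_def indicator_def)
      then show ?thesis using T''m[OF that i] by simp
    qed
    show "(\<lambda>t. emeasure (PiM (I - {i}) M) (T'' t i)) \<in> borel_measurable (M j)"
      using * ** by (simp cong: measurable_cong)
    have "emeasure (PiM (insert j (I - {i})) M) (T i) = (\<integral>\<^sup>+ x. indicator (T i) x \<partial>PiM (insert j (I - {i})) M)"
      using T'[OF i] by simp
    also have "\<dots> = (\<integral>\<^sup>+ t. (\<integral>\<^sup>+ x. indicator (T i) (x(j := t)) \<partial>PiM (I - {i}) M) \<partial>M j)"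
      using jI T'[OF i] by (intro product_nn_integral_insert_rev) auto
    also have "\<dots> = (\<integral>\<^sup>+ t. emeasure (PiM (I - {i}) M) (T'' t i) \<partial>M j)"
      using ** by (intro nn_integral_cong) auto
    finally show "emeasure (PiM (insert j I - {i}) M) (T i) = (\<integral>\<^sup>+ t. emeasure (PiM (I - {i}) M) (T'' t i) \<partial>M j)"
      using eqD[OF i] by simp
  qed
  have S'le: "emeasure (PiM I M) (S' t) \<le> m" for t
    unfolding m_def
  proof (intro emeasure_mono Tj subsetI)
    fix x assume "x \<in> S' t"
    then have x: "x \<in> space (PiM I M)" "x(j := t) \<in> S" by (simp_all add: S'_def)
    have "restrict (x(j := t)) I \<in> T j"
      using insert.prems(3)[OF x(2) insertI1] unfolding eqj .
    moreover have "restrict (x(j := t)) I = restrict x I"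
      using jI by (intro restrict_ext) auto
    moreover have "restrict x I = x"
      using x(1) by (simp add: space_PiM PiE_restrict)
    ultimately show "x \<in> T j" by simp
  qed
  \<comment> \<open>Null slices are left out because for \<open>n = 1\<close> the left side is 1
    even for them. They cost nothing: the bound \<open>le\<close> on the measure of the slice is
    trivial there.\<close>
  have IH: "emeasure (PiM I M) (S' t) ^ (n - 1) \<le> g t ^ n"
    if t: "t \<in> space (M j)" and pos: "emeasure (PiM I M) (S' t) > 0" for t
    unfolding n_def g_def
  proof (rule insert.IH[OF S'm[OF t] T''m[OF t] _ pos])
    fix x i assume x: "x \<in> S' t" and i: "i \<in> I"
    have xS: "x \<in> space (PiM I M)" "x(j := t) \<in> S" using x by (simp_all add: S'_def)
    have "restrict (x(j := t)) (insert j (I - {i})) \<in> T i"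
      using insert.prems(3)[OF xS(2) insertI2[OF i]] unfolding eqD[OF i] .
    moreover have "restrict (x(j := t)) (insert j (I - {i})) = (restrict x (I - {i}))(j := t)"
      by (rule ext) (simp add: restrict_def)
    moreover have "restrict x (I - {i}) \<in> space (PiM (I - {i}) M)"
      using xS(1) by (simp add: space_PiM PiE_def Pi_def)
    ultimately show "restrict x (I - {i}) \<in> T'' t i"
      unfolding T''_def by (intro CollectI conjI) metis+
  qed
  define N where "N = (\<Sum>i\<in>insert j I. emeasure (PiM (insert j I - {i}) M) (T i))"
  have N: "N = m + (\<Sum>i\<in>I. emeasure (PiM (insert j I - {i}) M) (T i))"
    using jI eqj by (simp add: N_def m_def)
  have "emeasure (PiM (insert j I) M) S ^ n \<le> N ^ Suc n"
  proof (cases "m = top")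
    case True
    then show ?thesis by (simp add: N)
  next
    case False
    then obtain m' where m': "m = ennreal m'" "m' \<ge> 0" by (metis ennreal_cases infinity_ennreal_def)
    define r where "r = root n m'"
    have r: "ennreal r ^ n = m" "r \<ge> 0"
      using m' n by (auto simp: r_def ennreal_power)
    \<comment> \<open>Multiply \<open>|S' t| \<le> m\<close> by the induction hypothesis. The bound is linear in the shadows of the
      slices, so no Hoelder inequality is needed to integrate over \<open>t\<close>.\<close>
    have le: "emeasure (PiM I M) (S' t) \<le> ennreal r * g t" if t: "t \<in> space (M j)" for t
    proof (cases "emeasure (PiM I M) (S' t) = 0")
      case False
      then have "emeasure (PiM I M) (S' t) ^ (n - 1) \<le> g t ^ n"
        using IH[OF t] by (simp add: zero_less_iff_neq_zero)
      then have "emeasure (PiM I M) (S' t) * emeasure (PiM I M) (S' t) ^ (n - 1) \<le> m * g t ^ n"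
        by (intro mult_mono S'le) auto
      also have "m * g t ^ n = (ennreal r * g t) ^ n" by (simp add: power_mult_distrib r)
      also have "emeasure (PiM I M) (S' t) * emeasure (PiM I M) (S' t) ^ (n - 1) = emeasure (PiM I M) (S' t) ^ n"
        using n by (metis power_eq_if not_gr_zero)
      finally show ?thesis using n by (rule ennreal_power_le_imp_le)
    qed simp
    have "emeasure (PiM (insert j I) M) S \<le> (\<integral>\<^sup>+ t. ennreal r * g t \<partial>M j)"
      unfolding S by (intro nn_integral_mono le)
    also have "\<dots> = ennreal r * (\<Sum>i\<in>I. emeasure (PiM (insert j I - {i}) M) (T i))"
      unfolding g_def using Tm by (simp add: nn_integral_cmult nn_integral_sum T)
    also have "\<dots> \<le> ennreal r * N" by (simp add: N mult_left_mono)
    finally have "emeasure (PiM (insert j I) M) S ^ n \<le> (ennreal r * N) ^ n" by (rule power_mono_ennreal)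
    also have "\<dots> = m * N ^ n" by (simp add: power_mult_distrib r)
    also have "\<dots> \<le> N * N ^ n" by (intro mult_mono) (auto simp: N)
    finally show ?thesis by simp
  qed
  then show ?case using jI by (simp add: N_def n_def)
qed

section \<open>Facet measure against the measure of coordinate shadows\<close>

lemma nn_integral_lborel_translate:
  fixes f :: "'a::euclidean_space \<Rightarrow> ennreal"
  assumes [measurable]: "f \<in> borel_measurable borel"
  shows "(\<integral>\<^sup>+ x. f (c + x) \<partial>lborel) = (\<integral>\<^sup>+ x. f x \<partial>lborel)"
proof -
  have "(\<integral>\<^sup>+ x. f x \<partial>lborel) = (\<integral>\<^sup>+ x. f x \<partial>distr lborel borel ((+) c))"
    by (simp add: lborel_distr_plus)
  also have "\<dots> = (\<integral>\<^sup>+ x. f (c + x) \<partial>lborel)"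
    by (subst nn_integral_distr) auto
  finally show ?thesis by simp
qed

lemma nn_integral_lborel_reflect:
  fixes f :: "'a::euclidean_space \<Rightarrow> ennreal"
  assumes [measurable]: "f \<in> borel_measurable borel"
  shows "(\<integral>\<^sup>+ x. f (c - x) \<partial>lborel) = (\<integral>\<^sup>+ x. f x \<partial>lborel)"
proof -
  have eq: "(lborel :: 'a measure) = distr lborel borel (\<lambda>x. c - x)"
    using lborel_affine[of "-1" c] by (simp add: density_1 one_ennreal_def[symmetric])
  have "(\<integral>\<^sup>+ x. f x \<partial>lborel) = (\<integral>\<^sup>+ x. f x \<partial>distr lborel borel (\<lambda>x. c - x))"
    using eq by simp
  also have "\<dots> = (\<integral>\<^sup>+ x. f (c - x) \<partial>lborel)"
    by (subst nn_integral_distr) auto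
  finally show ?thesis by simp
qed

text \<open>The uniqueness proof for Haar measure, applied to the translation invariant measure
  \<open>S \<mapsto> |k -` S|\<close>.\<close>

lemma emeasure_lborel_vimage_equivariant:
  fixes k :: "'a::euclidean_space \<Rightarrow> 'a"
  assumes k[measurable]: "k \<in> borel_measurable borel"
    and equi: "\<And>x. \<exists>w. \<forall>y. k (w + y) = x + k y"
    and S[measurable]: "S \<in> sets borel" and B[measurable]: "B \<in> sets borel"
  shows "emeasure lborel S * emeasure lborel (k -` B) = emeasure lborel B * emeasure lborel (k -` S)"
proof -
  have vim: "emeasure lborel (k -` A) = (\<integral>\<^sup>+ y. indicator A (k y) \<partial>lborel)" if "A \<in> sets borel" for A
  proof -
    have "k -` A \<in> sets borel" using measurable_sets[OF k that] by simp
    then have "emeasure lborel (k -` A) = (\<integral>\<^sup>+ y. indicator (k -` A) y \<partial>lborel)" by simp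
    also have "\<dots> = (\<integral>\<^sup>+ y. indicator A (k y) \<partial>lborel)"
      by (simp add: indicator_def vimage_def)
    finally show ?thesis .
  qed
  have shift: "(\<integral>\<^sup>+ y. indicator A (x + k y) \<partial>lborel) = emeasure lborel (k -` A)"
    if [measurable]: "A \<in> sets borel" for A x
  proof -
    \<comment> \<open>Equivariance turns a translation by \<open>x\<close> after \<open>k\<close>
      into a translation by \<open>w\<close> before it, which Lebesgue measure does not see.\<close>
    obtain w where w: "k (w + y) = x + k y" for y using equi[of x] by blast
    have "(\<integral>\<^sup>+ y. indicator A (x + k y) \<partial>lborel) = (\<integral>\<^sup>+ y. indicator A (k (w + y)) \<partial>lborel)"
      by (simp add: w)
    also have "\<dots> = (\<integral>\<^sup>+ y. indicator A (k y) \<partial>lborel)"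
      by (rule nn_integral_lborel_translate) measurable
    finally show ?thesis using vim[OF that] by simp
  qed
  have "emeasure lborel S * emeasure lborel (k -` B)
      = (\<integral>\<^sup>+ x. indicator S x * emeasure lborel (k -` B) \<partial>lborel)"
    by (subst nn_integral_multc) auto
  also have "\<dots> = (\<integral>\<^sup>+ x. (\<integral>\<^sup>+ y. indicator S x * indicator B (k y - x) \<partial>lborel) \<partial>lborel)"
    using shift[OF B, of "- x" for x]
    by (subst nn_integral_cmult) (auto simp: algebra_simps)
  also have "\<dots> = (\<integral>\<^sup>+ y. (\<integral>\<^sup>+ x. indicator S x * indicator B (k y - x) \<partial>lborel) \<partial>lborel)"
    by (rule lborel_pair.Fubini') measurable
  \<comment> \<open>The substitution \<open>z = k y - x\<close> moves \<open>k y\<close> from the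
    indicator of \<open>B\<close> to that of \<open>S\<close>. After a second exchange of integrals
    the inner integral over \<open>y\<close> is the volume of the preimage of
    \<open>S\<close>.\<close>
  also have "\<dots> = (\<integral>\<^sup>+ y. (\<integral>\<^sup>+ z. indicator S (k y - z) * indicator B z \<partial>lborel) \<partial>lborel)"
  proof (rule nn_integral_cong)
    fix y
    have [measurable]: "(\<lambda>x. indicator S x * indicator B (k y - x) :: ennreal) \<in> borel_measurable borel"
      by measurable
    show "(\<integral>\<^sup>+ x. indicator S x * indicator B (k y - x) \<partial>lborel)
        = (\<integral>\<^sup>+ z. indicator S (k y - z) * indicator B z \<partial>lborel)"
      using nn_integral_lborel_reflect[of "\<lambda>x. indicator S x * indicator B (k y - x)" "k y"] by simp
  qed
  also have "\<dots> = (\<integral>\<^sup>+ z. (\<integral>\<^sup>+ y. indicator S (k y - z) * indicator B z \<partial>lborel) \<partial>lborel)"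
    by (rule lborel_pair.Fubini'[symmetric]) measurable
  also have "\<dots> = (\<integral>\<^sup>+ z. emeasure lborel (k -` S) * indicator B z \<partial>lborel)"
    using shift[OF S, of "- z" for z]
    by (subst nn_integral_multc) (auto simp: algebra_simps)
  also have "\<dots> = emeasure lborel B * emeasure lborel (k -` S)"
    by (subst nn_integral_cmult) (auto simp: mult.commute)
  finally show ?thesis .
qed

text \<open>The projection along \<open>e\<close> onto the hyperplane \<open>{x. a \<bullet> x = b}\<close>.\<close>

definition oblique_proj :: "'a::euclidean_space \<Rightarrow> real \<Rightarrow> 'a \<Rightarrow> 'a \<Rightarrow> 'a" where
  "oblique_proj a b e x = x - ((a \<bullet> x - b) / (a \<bullet> e)) *\<^sub>R e"

text \<open>For \<open>A\<close> inside that hyperplane, the orthogonal projection of \<open>A\<close> along the basis vector \<open>i\<close>,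
  in coordinates.\<close>

definition shadow :: "'a::euclidean_space \<Rightarrow> real \<Rightarrow> 'a \<Rightarrow> 'a set \<Rightarrow> ('a \<Rightarrow> real) set" where
  "shadow a b i A = {x \<in> space (PiM (Basis - {i}) (\<lambda>_. lborel)).
     oblique_proj a b i (\<Sum>j\<in>Basis - {i}. x j *\<^sub>R j) \<in> A}"

lemma borel_measurable_oblique_proj[measurable]: "oblique_proj a b e \<in> borel_measurable borel"
  unfolding oblique_proj_def[abs_def] by measurable

lemma oblique_proj_add_scaleR: "a \<bullet> e \<noteq> 0 \<Longrightarrow> oblique_proj a b e (x + t *\<^sub>R e) = oblique_proj a b e x"
  by (simp add: oblique_proj_def inner_add_right add_divide_distrib diff_divide_distrib algebra_simps)

lemma oblique_proj_eq: "a \<bullet> x = b \<Longrightarrow> oblique_proj a b e x = x"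
  by (simp add: oblique_proj_def)

lemma inner_oblique_proj: "a \<bullet> e \<noteq> 0 \<Longrightarrow> a \<bullet> oblique_proj a b e x = b"
  by (simp add: oblique_proj_def inner_diff_right)

text \<open>The oblique slab is the preimage of the orthogonal one under the affine bijection
  \<open>k\<close>, which keeps the foot point in the hyperplane and replaces height along
  \<open>e\<close> by the same height along the unit normal. The volume of preimages under
  \<open>k\<close> is translation invariant, hence proportional to Lebesgue measure.\<close>

lemma oblique_slab_le_hyperplane_measure:
  fixes a e :: "'a::euclidean_space"
  assumes ae: "a \<bullet> e \<noteq> 0"
  shows "\<exists>C::real. \<forall>A\<in>sets borel.
    emeasure lborel {y. (a \<bullet> y - b) / (a \<bullet> e) \<in> {0..1} \<and> oblique_proj a b e y \<in> A}
      \<le> ennreal C * hyperplane_measure a b A"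
proof -
  have a: "a \<noteq> 0" using ae by auto
  define k where "k y = oblique_proj a b e y + ((a \<bullet> y - b) / (a \<bullet> e * norm a)) *\<^sub>R a" for y
  define g where "g x = x - ((a \<bullet> x - b) / (norm a)\<^sup>2) *\<^sub>R a + ((a \<bullet> x - b) / norm a) *\<^sub>R e" for x
  define B where "B = ball (0::'a) 1"
  have aa: "a \<bullet> a = norm a * norm a" by (simp add: power2_norm_eq_inner[symmetric] power2_eq_square)
  have ak: "a \<bullet> k y - b = (a \<bullet> y - b) / (a \<bullet> e) * norm a" for y
    using a ae by (simp add: k_def inner_add_right inner_oblique_proj aa)
  have k_meas[measurable]: "k \<in> borel_measurable borel"
    unfolding k_def[abs_def] by measurable
  have equi: "\<exists>w. \<forall>y. k (w + y) = x + k y" for x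
  proof (intro exI allI)
    fix y
    \<comment> \<open>The linear part of \<open>g\<close>, the inverse of \<open>k\<close>, applied
      to \<open>x\<close>.\<close>
    define w where "w = x - ((a \<bullet> x) / (norm a)\<^sup>2) *\<^sub>R a + ((a \<bullet> x) / norm a) *\<^sub>R e"
    have aw: "a \<bullet> w = (a \<bullet> x) / norm a * (a \<bullet> e)"
      using a by (simp add: w_def inner_add_right inner_diff_right power2_norm_eq_inner)
    have "(a \<bullet> (w + y) - b) / (a \<bullet> e) = (a \<bullet> x) / norm a + (a \<bullet> y - b) / (a \<bullet> e)"
      using ae by (simp add: inner_add_right aw field_simps)
    moreover have "(a \<bullet> (w + y) - b) / (a \<bullet> e * norm a) = (a \<bullet> x) / (norm a)\<^sup>2 + (a \<bullet> y - b) / (a \<bullet> e * norm a)"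
      using ae a by (simp add: inner_add_right aw field_simps power2_eq_square)
    ultimately show "k (w + y) = x + k y"
      unfolding k_def oblique_proj_def by (simp add: w_def scaleR_add_left)
  qed
  have gk: "g (k y) = y" for y
  proof -
    have "(a \<bullet> k y - b) / (norm a)\<^sup>2 = (a \<bullet> y - b) / (a \<bullet> e * norm a)"
      "(a \<bullet> k y - b) / norm a = (a \<bullet> y - b) / (a \<bullet> e)"
      using a by (simp_all add: ak power2_eq_square)
    then show ?thesis by (simp add: g_def k_def oblique_proj_def)
  qed
  have "compact (g ` cball 0 1)"
    unfolding g_def by (intro compact_continuous_image continuous_intros) (use a in auto)
  moreover have "k -` B \<subseteq> g ` cball 0 1"
  proof
    fix y assume "y \<in> k -` B"
    then have "k y \<in> cball 0 1" by (simp add: B_def)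
    then show "y \<in> g ` cball 0 1" using gk[of y] by (metis image_eqI)
  qed
  ultimately have "bounded (k -` B)" by (meson bounded_subset compact_imp_bounded)
  then have fin: "emeasure lborel (k -` B) < \<infinity>" by (rule emeasure_bounded_finite)
  have Bfin: "emeasure lborel B < \<infinity>" unfolding B_def by (rule emeasure_bounded_finite) simp
  have Bpos: "emeasure lborel B \<noteq> 0"
    using content_ball_pos[of 1 "0::'a"] by (auto simp: B_def measure_def)
  \<comment> \<open>The unit ball has finite nonzero volume and therefore fixes the factor of
    proportionality. Its value is the absolute Jacobian of \<open>g\<close>, that is
    \<open>\<bar>a \<bullet> e\<bar> / norm a\<close>.\<close>
  define C where "C = enn2real (emeasure lborel (k -` B)) / enn2real (emeasure lborel B)"
  show ?thesis
  proof (intro exI ballI)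
    fix A :: "'a set" assume A[measurable]: "A \<in> sets borel"
    define S where "S = {x. (a \<bullet> x - b) / norm a \<in> {0..1} \<and> x - ((a \<bullet> x - b) / (norm a)\<^sup>2) *\<^sub>R a \<in> A}"
    have [measurable]: "S \<in> sets borel" unfolding S_def by measurable
    have "k -` S = {y. (a \<bullet> y - b) / (a \<bullet> e) \<in> {0..1} \<and> oblique_proj a b e y \<in> A}"
    proof -
      have "k y - ((a \<bullet> k y - b) / (norm a)\<^sup>2) *\<^sub>R a = oblique_proj a b e y"
        "(a \<bullet> k y - b) / norm a = (a \<bullet> y - b) / (a \<bullet> e)" for y
        using a by (simp_all add: ak power2_eq_square) (simp add: k_def)
      then show ?thesis by (simp add: S_def vimage_def)
    qed
    moreover have "emeasure lborel (k -` S) = ennreal C * emeasure lborel S"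
    proof -
      have "emeasure lborel S * emeasure lborel (k -` B) = emeasure lborel B * emeasure lborel (k -` S)"
        by (rule emeasure_lborel_vimage_equivariant[OF k_meas equi]) (auto simp: B_def)
      moreover obtain \<beta> where \<beta>: "emeasure lborel B = ennreal \<beta>" "\<beta> > 0"
        using Bfin Bpos by (cases "emeasure lborel B") (auto simp: less_le)
      moreover obtain \<gamma> where \<gamma>: "emeasure lborel (k -` B) = ennreal \<gamma>" "\<gamma> \<ge> 0"
        using fin by (cases "emeasure lborel (k -` B)") auto
      ultimately have eq: "emeasure lborel S * ennreal \<gamma> = ennreal \<beta> * emeasure lborel (k -` S)" by simp
      have "emeasure lborel (k -` S) = ennreal (1 / \<beta>) * (ennreal \<beta> * emeasure lborel (k -` S))"
        using \<beta> by (simp add: mult.assoc[symmetric] ennreal_mult[symmetric])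
      also have "\<dots> = ennreal (1 / \<beta>) * ennreal \<gamma> * emeasure lborel S"
        by (simp add: eq[symmetric] mult_ac)
      also have "ennreal (1 / \<beta>) * ennreal \<gamma> = ennreal C"
        using \<beta> \<gamma> by (simp add: C_def ennreal_mult[symmetric])
      finally show ?thesis .
    qed
    ultimately show "emeasure lborel {y. (a \<bullet> y - b) / (a \<bullet> e) \<in> {0..1} \<and> oblique_proj a b e y \<in> A}
      \<le> ennreal C * hyperplane_measure a b A"
      by (simp add: hyperplane_measure_def S_def)
  qed
qed

lemma Basis_sum_measurable[measurable]:
  "(\<lambda>x. \<Sum>j\<in>J. x j *\<^sub>R (j::'a::euclidean_space)) \<in> borel_measurable (PiM J (\<lambda>_. lborel))"
  by (intro borel_measurable_sum borel_measurable_scaleR) auto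

lemma shadow_measurable:
  fixes A :: "'a::euclidean_space set"
  assumes [measurable]: "A \<in> sets borel"
  shows "shadow a b i A \<in> sets (PiM (Basis - {i}) (\<lambda>_. lborel))"
  unfolding shadow_def by measurable

text \<open>Fubini in the coordinate \<open>i\<close>: along a line in direction \<open>i\<close>
  the foot point is constant and the height grows at unit speed, so the line meets the slab in an
  interval of length 1 or not at all.\<close>

lemma emeasure_shadow:
  fixes A :: "'a::euclidean_space set"
  assumes i: "i \<in> Basis" and ai: "a \<bullet> i \<noteq> 0" and A[measurable]: "A \<in> sets borel"
  shows "emeasure (PiM (Basis - {i}) (\<lambda>_. lborel)) (shadow a b i A)
    = emeasure lborel {y. (a \<bullet> y - b) / (a \<bullet> i) \<in> {0..1} \<and> oblique_proj a b i y \<in> A}"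
proof -
  interpret product_sigma_finite "\<lambda>_::'a. lborel :: real measure" ..
  define Y where "Y = {y. (a \<bullet> y - b) / (a \<bullet> i) \<in> {0..1} \<and> oblique_proj a b i y \<in> A}"
  have [measurable]: "Y \<in> sets borel" unfolding Y_def by measurable
  define \<phi> where "\<phi> x = (\<Sum>j\<in>Basis - {i}. x j *\<^sub>R j)" for x :: "'a \<Rightarrow> real"
  have ins: "insert i (Basis - {i}) = Basis" using i by auto
  have "emeasure lborel Y = (\<integral>\<^sup>+ y. indicator Y y \<partial>lborel)" by simp
  also have "\<dots> = (\<integral>\<^sup>+ x. indicator Y (\<Sum>j\<in>Basis. x j *\<^sub>R j) \<partial>PiM Basis (\<lambda>_. lborel))"
    by (subst lborel_eq, subst nn_integral_distr) auto
  also have "\<dots> = (\<integral>\<^sup>+ x. indicator Y (\<Sum>j\<in>Basis. x j *\<^sub>R j) \<partial>PiM (insert i (Basis - {i})) (\<lambda>_. lborel))"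
    by (simp only: ins)
  also have "\<dots> = (\<integral>\<^sup>+ x. (\<integral>\<^sup>+ t. indicator Y (\<Sum>j\<in>Basis. (x(i := t)) j *\<^sub>R j) \<partial>lborel) \<partial>PiM (Basis - {i}) (\<lambda>_. lborel))"
    by (rule product_nn_integral_insert) (simp_all add: ins)
  also have "\<dots> = (\<integral>\<^sup>+ x. indicator (shadow a b i A) x \<partial>PiM (Basis - {i}) (\<lambda>_. lborel))"
  proof (rule nn_integral_cong)
    fix x :: "'a \<Rightarrow> real" assume x: "x \<in> space (PiM (Basis - {i}) (\<lambda>_. lborel))"
    define c where "c = (a \<bullet> \<phi> x - b) / (a \<bullet> i)"
    have "(\<Sum>j\<in>Basis. (x(i := t)) j *\<^sub>R j) = \<phi> x + t *\<^sub>R i" for t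
      using i by (subst sum.remove[of _ i]) (auto simp: \<phi>_def add.commute intro!: sum.cong)
    moreover have "(a \<bullet> (\<phi> x + t *\<^sub>R i) - b) / (a \<bullet> i) = c + t" for t
      using ai by (simp add: c_def inner_add_right field_simps)
    ultimately have "indicator Y (\<Sum>j\<in>Basis. (x(i := t)) j *\<^sub>R j)
        = indicator (shadow a b i A) x * (indicator {- c..1 - c} t :: ennreal)" for t
      using x oblique_proj_add_scaleR[OF ai, of b "\<phi> x" t]
      by (auto simp: Y_def shadow_def \<phi>_def indicator_def)
    then show "(\<integral>\<^sup>+ t. indicator Y (\<Sum>j\<in>Basis. (x(i := t)) j *\<^sub>R j) \<partial>lborel) = indicator (shadow a b i A) x"
      by (simp add: nn_integral_cmult)
  qed
  also have "\<dots> = emeasure (PiM (Basis - {i}) (\<lambda>_. lborel)) (shadow a b i A)"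
    using shadow_measurable[OF A] by simp
  finally show ?thesis unfolding Y_def by simp
qed

text \<open>Adding the constants over the basis gives one \<open>C\<close> for all directions that
  are transversal to the facet. For \<open>a \<bullet> i = 0\<close> the division by zero would make
  \<open>oblique_proj\<close> the identity, so \<open>shadow\<close> would no longer be a projection
  along \<open>i\<close>.\<close>

lemma facet_shadow_le:
  fixes P :: "'a::euclidean_space set"
  assumes "boundary_measure_on P \<sigma>" "F facet_of P"
  shows "\<exists>a b. \<exists>C::real. affine hull F = {x. a \<bullet> x = b} \<and> C \<ge> 0 \<and>
    (\<forall>i\<in>Basis. a \<bullet> i \<noteq> 0 \<longrightarrow> (\<forall>A\<in>sets borel. A \<subseteq> F \<longrightarrow>
      emeasure (PiM (Basis - {i}) (\<lambda>_. lborel)) (shadow a b i A) \<le> ennreal C * emeasure \<sigma> A))"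
proof -
  have "\<exists>a b c. a \<noteq> 0 \<and> affine hull F = {x. a \<bullet> x = b} \<and> c > (0::real) \<and>
     (\<forall>A\<in>sets borel. A \<subseteq> F \<longrightarrow> emeasure \<sigma> A = ennreal c * hyperplane_measure a b A)"
    using assms unfolding boundary_measure_on_def by (elim conjE allE[of _ F] impE)
  then obtain a b c where F: "affine hull F = {x. a \<bullet> x = b}" "c > (0::real)"
    "\<And>A. A \<in> sets borel \<Longrightarrow> A \<subseteq> F \<Longrightarrow> emeasure \<sigma> A = ennreal c * hyperplane_measure a b A"
    by (elim exE conjE) simp
  have "\<forall>i\<in>Basis. \<exists>C::real. a \<bullet> i \<noteq> 0 \<longrightarrow> (\<forall>A\<in>sets borel.
    emeasure lborel {y. (a \<bullet> y - b) / (a \<bullet> i) \<in> {0..1} \<and> oblique_proj a b i y \<in> A}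
      \<le> ennreal C * hyperplane_measure a b A)"
    using oblique_slab_le_hyperplane_measure by blast
  then obtain C where C: "\<forall>i\<in>Basis. a \<bullet> i \<noteq> 0 \<longrightarrow> (\<forall>A\<in>sets borel.
    emeasure lborel {y. (a \<bullet> y - b) / (a \<bullet> i) \<in> {0..1} \<and> oblique_proj a b i y \<in> A}
      \<le> ennreal (C i) * hyperplane_measure a b A)"
    by (rule bchoice[THEN exE])
  define D where "D = (\<Sum>i\<in>Basis. \<bar>C i\<bar>) / c"
  have "D \<ge> 0" using F(2) by (simp add: D_def sum_nonneg)
  moreover have "emeasure (PiM (Basis - {i}) (\<lambda>_. lborel)) (shadow a b i A) \<le> ennreal D * emeasure \<sigma> A"
    if i: "i \<in> Basis" "a \<bullet> i \<noteq> 0" and A: "A \<in> sets borel" "A \<subseteq> F" for i A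
  proof -
    have "emeasure (PiM (Basis - {i}) (\<lambda>_. lborel)) (shadow a b i A) \<le> ennreal (C i) * hyperplane_measure a b A"
      using C[rule_format, OF i A(1)] emeasure_shadow[OF i A(1), of b] by simp
    also have "C i \<le> (\<Sum>i\<in>Basis. \<bar>C i\<bar>)"
      using member_le_sum[of i Basis "\<lambda>i. \<bar>C i\<bar>"] i by auto
    then have "ennreal (C i) * hyperplane_measure a b A \<le> ennreal (D * c) * hyperplane_measure a b A"
      using F(2) by (intro mult_right_mono ennreal_leI) (simp_all add: D_def)
    also have "\<dots> = ennreal D * emeasure \<sigma> A"
      using F(3)[OF A] F(2) \<open>D \<ge> 0\<close> by (simp add: ennreal_mult mult.assoc)
    finally show ?thesis .
  qed
  ultimately show ?thesis using F(1) by blast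
qed

section \<open>Volume outside a convex set against boundary measure\<close>

lemma line_exits_outside_convex:
  fixes P K :: "'a::euclidean_space set"
  assumes "bounded P" "y \<in> interior P" "convex K" "y \<notin> K" "e \<noteq> 0"
  shows "\<exists>s. y + s *\<^sub>R e \<in> frontier P - K"
proof (rule ccontr)
  assume *: "\<not> ?thesis"
  obtain c where c: "c > 0" "y + c *\<^sub>R e \<in> frontier P"
    using ray_to_frontier[OF assms(1,2,5)] by blast
  obtain d where d: "d > 0" "y + d *\<^sub>R (- e) \<in> frontier P"
    using ray_to_frontier[OF assms(1,2), of "- e"] assms(5) by auto
  have "y + c *\<^sub>R e \<in> K" "y - d *\<^sub>R e \<in> K"
    using * c d by (auto dest: spec[of _ c] spec[of _ "- d"])
  then have "(d / (c + d)) *\<^sub>R (y + c *\<^sub>R e) + (c / (c + d)) *\<^sub>R (y - d *\<^sub>R e) \<in> K"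
    using c(1) d(1) by (intro convexD[OF \<open>convex K\<close>]) (auto simp: add_divide_distrib[symmetric])
  also have "(d / (c + d)) *\<^sub>R (y + c *\<^sub>R e) + (c / (c + d)) *\<^sub>R (y - d *\<^sub>R e)
      = (d / (c + d) + c / (c + d)) *\<^sub>R y"
    by (simp add: algebra_simps)
  also have "d / (c + d) + c / (c + d) = 1"
    using c(1) d(1) by (simp add: add_divide_distrib[symmetric])
  finally show False using assms(4) by simp
qed

lemma frontier_polyhedron_eq_Union_facets:
  fixes P :: "'a::euclidean_space set"
  assumes "polyhedron P" "interior P \<noteq> {}"
  shows "frontier P = \<Union>{F. F facet_of P}"
  using assms rel_boundary_of_polyhedron[OF assms(1)]
  by (simp add: frontier_def closure_closed polyhedron_imp_closed rel_interior_nonempty_interior)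

text \<open>The frontier of a convex set is Lebesgue null. This lets \<open>interior K\<close> be
  used for the integral over \<open>P\<close> while the volume estimate is applied to
  \<open>closure K\<close>.\<close>

lemma emeasure_lborel_convex_complement:
  fixes P K :: "'a::euclidean_space set"
  assumes "convex K" "P \<in> sets borel"
  shows "emeasure lborel (P - interior K) = emeasure lborel (P - closure K)"
proof (rule emeasure_eq_AE)
  have "frontier K \<in> null_sets lborel"
    using negligible_convex_frontier[OF assms(1)]
    by (simp add: negligible_iff_null_sets null_sets_completion_iff)
  then have "AE x in lborel. x \<notin> frontier K" by (rule AE_not_in)
  then show "AE x in lborel. (x \<in> P - interior K) = (x \<in> P - closure K)"
    by eventually_elim (use interior_subset closure_subset in \<open>auto simp: frontier_def\<close>)
qed (use assms in auto)

lemma volume_complement_convex_le: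
  fixes P :: "'a::euclidean_space set"
  assumes P: "polyhedron P" "compact P" "interior P \<noteq> {}"
    and \<sigma>: "boundary_measure_on P \<sigma>" and dim: "DIM('a) \<ge> 2"
  shows "\<exists>C::real. C \<ge> 0 \<and> (\<forall>K. closed K \<longrightarrow> convex K \<longrightarrow> K \<subseteq> P \<longrightarrow>
    emeasure lborel (P - K) ^ (DIM('a) - 1) \<le> (ennreal C * emeasure \<sigma> (frontier P - K)) ^ DIM('a))"
proof -
  interpret product_sigma_finite "\<lambda>_::'a. lborel :: real measure" ..
  define Fs where "Fs = {F. F facet_of P}"
  have fin: "finite Fs" unfolding Fs_def by (rule finite_polyhedron_facets[OF P(1)])
  have fr: "frontier P = \<Union>Fs"
    unfolding Fs_def by (rule frontier_polyhedron_eq_Union_facets[OF P(1,3)])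
  have fr_F: "F \<subseteq> frontier P" if "F \<in> Fs" for F
    using that unfolding fr by blast
  have sets\<sigma>: "sets \<sigma> = sets borel" using \<sigma> by (simp add: boundary_measure_on_def)
  define Q where "Q F a b C \<longleftrightarrow> affine hull F = {x. a \<bullet> x = b} \<and> C \<ge> 0 \<and>
    (\<forall>i\<in>Basis. a \<bullet> i \<noteq> 0 \<longrightarrow> (\<forall>A\<in>sets borel. A \<subseteq> F \<longrightarrow>
      emeasure (PiM (Basis - {i}) (\<lambda>_. lborel)) (shadow a b i A) \<le> ennreal C * emeasure \<sigma> A))"
    for F and a :: 'a and b C :: real
  have "\<exists>a b C. Q F a b C" if "F \<in> Fs" for F
    using facet_shadow_le[OF \<sigma>, of F] that by (simp add: Fs_def Q_def)
  then obtain a b C where Q: "\<And>F. F \<in> Fs \<Longrightarrow> Q F (a F) (b F) (C F)"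
    by metis
  have C: "\<forall>F\<in>Fs. C F \<ge> 0 \<and>
    (\<forall>i\<in>Basis. a F \<bullet> i \<noteq> 0 \<longrightarrow> (\<forall>A\<in>sets borel. A \<subseteq> F \<longrightarrow>
      emeasure (PiM (Basis - {i}) (\<lambda>_. lborel)) (shadow (a F) (b F) i A) \<le> ennreal (C F) * emeasure \<sigma> A))"
    using Q unfolding Q_def by simp
  have hull: "affine hull F = {x. a F \<bullet> x = b F}" if "F \<in> Fs" for F
    using Q[OF that] by (simp add: Q_def)
  have face: "F = affine hull F \<inter> P" if "F \<in> Fs" for F
    using that P(1) by (intro face_of_imp_eq_affine_Int polyhedron_imp_convex facet_of_imp_face_of) (auto simp: Fs_def)
  have closedF: "closed F" if "F \<in> Fs" for F
    using face[OF that] compact_imp_closed[OF P(2)] by (metis affine_closed affine_affine_hull closed_Int)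
  \<comment> \<open>Summing over facets bounds the shadow in one direction; the factor
    \<open>DIM('a)\<close> comes from adding the shadows over all directions. Nothing here depends
    on \<open>K\<close>, so one constant serves every sublevel set of every
    \<open>u\<close>.\<close>
  define D where "D = real DIM('a) * (\<Sum>F\<in>Fs. C F)"
  have C0: "(\<Sum>F\<in>Fs. C F) \<ge> 0" using C by (intro sum_nonneg) auto
  have "emeasure lborel (P - K) ^ (DIM('a) - 1) \<le> (ennreal D * emeasure \<sigma> (frontier P - K)) ^ DIM('a)"
    if K: "closed K" "convex K" "K \<subseteq> P" for K
  proof -
    define s where "s = emeasure \<sigma> (frontier P - K)"
    \<comment> \<open>Coordinates of the points of \<open>interior P - K\<close>. The frontier is
      dropped as a null set, because only from an interior point is a line sure to leave
      \<open>P\<close> in both directions.\<close>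
    define S where "S = {x \<in> space (PiM Basis (\<lambda>_. lborel)). (\<Sum>j\<in>Basis. x j *\<^sub>R j) \<in> interior P - K}"
    define T where "T i = (\<Union>F\<in>{F\<in>Fs. a F \<bullet> i \<noteq> 0}. shadow (a F) (b F) i (F - K))" for i
    have [measurable]: "interior P - K \<in> sets borel" "K \<in> sets borel" "P \<in> sets borel"
      using K(1) P(2) by (auto simp: compact_imp_closed)
    have FK: "F - K \<in> sets borel" if "F \<in> Fs" for F
      using closedF[OF that] K(1) by auto
    have [measurable]: "frontier P - K \<in> sets borel"
      using K(1) by (intro sets.Diff borel_closed) auto
    have S_meas: "S \<in> sets (PiM Basis (\<lambda>_. lborel))" unfolding S_def by measurable
    have vol: "emeasure lborel (P - K) = emeasure (PiM Basis (\<lambda>_. lborel)) S"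
    proof -
      have "frontier P \<in> null_sets lborel"
        using negligible_convex_frontier[OF polyhedron_imp_convex[OF P(1)]]
        by (simp add: negligible_iff_null_sets null_sets_completion_iff)
      then have "AE x in lborel. x \<notin> frontier P" by (rule AE_not_in)
      then have "AE x in lborel. (x \<in> P - K) = (x \<in> interior P - K)"
        by eventually_elim (use interior_subset closure_subset in \<open>auto simp: frontier_def\<close>)
      then have "emeasure lborel (P - K) = emeasure lborel (interior P - K)"
        by (rule emeasure_eq_AE) auto
      also have "\<dots> = emeasure (PiM Basis (\<lambda>_. lborel)) S"
        by (subst lborel_eq, subst emeasure_distr) (auto simp: S_def vimage_def Int_def intro!: arg_cong2[where f=emeasure])
      finally show ?thesis .
    qed
    have T_meas: "T i \<in> sets (PiM (Basis - {i}) (\<lambda>_. lborel))" for i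
      unfolding T_def using fin FK by (intro sets.finite_UN shadow_measurable) auto
    have cover: "restrict x (Basis - {i}) \<in> T i" if x: "x \<in> S" and i: "i \<in> Basis" for x i
    proof -
      define y where "y = (\<Sum>j\<in>Basis. x j *\<^sub>R j)"
      define w where "w = (\<Sum>j\<in>Basis - {i}. x j *\<^sub>R j)"
      have y: "y \<in> interior P" "y \<notin> K" using x by (auto simp: S_def y_def)
      obtain r where r: "y + r *\<^sub>R i \<in> frontier P - K"
        using line_exits_outside_convex[OF compact_imp_bounded[OF P(2)] y(1) K(2) y(2) nonzero_Basis[OF i]] by blast
      then obtain F where F: "F \<in> Fs" "y + r *\<^sub>R i \<in> F - K" using fr by auto
      have aF: "a F \<bullet> (y + r *\<^sub>R i) = b F"
        using face[OF F(1)] hull[OF F(1)] F(2) by blast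
      \<comment> \<open>The facet is the whole intersection of its hyperplane with \<open>P\<close>,
        so an interior point lies off that hyperplane. A line from \<open>y\<close> that reaches it
        is transversal, hence only facets with \<open>a F \<bullet> i \<noteq> 0\<close> are
        hit.\<close>
      have "y \<notin> F" using fr F(1) y(1) by (auto simp: frontier_def)
      then have "a F \<bullet> y \<noteq> b F"
        using face[OF F(1)] hull[OF F(1)] y(1) interior_subset by blast
      then have ai: "a F \<bullet> i \<noteq> 0" using aF by (auto simp: inner_add_right)
      \<comment> \<open>Since \<open>w\<close> is \<open>y\<close> without its coordinate along
        \<open>i\<close>, projecting \<open>w\<close> along \<open>i\<close> onto the hyperplane
        recovers the exit point.\<close>
      have "y + r *\<^sub>R i = w + (x i + r) *\<^sub>R i"
        using i unfolding y_def w_def by (subst sum.remove[of _ i]) (auto simp: algebra_simps)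
      then have "oblique_proj (a F) (b F) i w = y + r *\<^sub>R i"
        using oblique_proj_eq[OF aF] oblique_proj_add_scaleR[OF ai] by metis
      moreover have "(\<Sum>j\<in>Basis - {i}. restrict x (Basis - {i}) j *\<^sub>R j) = w"
        unfolding w_def by (intro sum.cong) auto
      moreover have "restrict x (Basis - {i}) \<in> space (PiM (Basis - {i}) (\<lambda>_. lborel))"
        by (simp add: space_PiM)
      ultimately have "restrict x (Basis - {i}) \<in> shadow (a F) (b F) i (F - K)"
        using F(2) unfolding shadow_def by simp
      then show ?thesis using F(1) ai unfolding T_def by blast
    qed
    have T_le: "emeasure (PiM (Basis - {i}) (\<lambda>_. lborel)) (T i) \<le> ennreal (\<Sum>F\<in>Fs. C F) * s"
      if i: "i \<in> Basis" for i
    proof -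
      have "emeasure (PiM (Basis - {i}) (\<lambda>_. lborel)) (T i)
          \<le> (\<Sum>F\<in>{F\<in>Fs. a F \<bullet> i \<noteq> 0}. emeasure (PiM (Basis - {i}) (\<lambda>_. lborel)) (shadow (a F) (b F) i (F - K)))"
        unfolding T_def using fin FK by (intro emeasure_subadditive_finite) (auto intro: shadow_measurable)
      also have "\<dots> \<le> (\<Sum>F\<in>{F\<in>Fs. a F \<bullet> i \<noteq> 0}. ennreal (C F) * s)"
      proof (rule sum_mono)
        fix F assume F: "F \<in> {F\<in>Fs. a F \<bullet> i \<noteq> 0}"
        then have "emeasure (PiM (Basis - {i}) (\<lambda>_. lborel)) (shadow (a F) (b F) i (F - K)) \<le> ennreal (C F) * emeasure \<sigma> (F - K)"
          using C i FK by simp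
        also have "emeasure \<sigma> (F - K) \<le> s"
          unfolding s_def using F fr_F[of F] by (intro emeasure_mono) (auto simp: sets\<sigma>)
        finally show "emeasure (PiM (Basis - {i}) (\<lambda>_. lborel)) (shadow (a F) (b F) i (F - K)) \<le> ennreal (C F) * s"
          by (simp add: mult_left_mono)
      qed
      also have "\<dots> \<le> (\<Sum>F\<in>Fs. ennreal (C F) * s)"
        using fin by (intro sum_mono2) auto
      also have "\<dots> = ennreal (\<Sum>F\<in>Fs. C F) * s"
        using C by (subst sum_distrib_right[symmetric], subst sum_ennreal) auto
      finally show ?thesis .
    qed
    show ?thesis
    proof (cases "emeasure (PiM Basis (\<lambda>_. lborel)) S = 0")
      \<comment> \<open>\<open>weak_Loomis_Whitney\<close> wants positive measure. For null
        \<open>S\<close> the left side is 0, its exponent being positive in dimension at least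
        2.\<close>
      case True
      then show ?thesis using dim by (simp add: vol zero_power)
    next
      case False
      then have "emeasure (PiM Basis (\<lambda>_. lborel)) S ^ (DIM('a) - 1)
          \<le> (\<Sum>i\<in>(Basis::'a set). emeasure (PiM (Basis - {i}) (\<lambda>_. lborel)) (T i)) ^ DIM('a)"
        using S_meas T_meas cover by (intro weak_Loomis_Whitney) (auto simp: zero_less_iff_neq_zero)
      also have "(\<Sum>i\<in>(Basis::'a set). emeasure (PiM (Basis - {i}) (\<lambda>_. lborel)) (T i))
          \<le> of_nat DIM('a) * (ennreal (\<Sum>F\<in>Fs. C F) * s)"
        using T_le by (rule sum_bounded_above)
      also have "\<dots> = ennreal D * s"
        using C0 by (simp add: D_def ennreal_mult mult.assoc ennreal_of_nat_eq_real_of_nat)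
      finally show ?thesis by (simp add: vol s_def power_mono_ennreal)
    qed
  qed
  moreover have "D \<ge> 0" using C0 by (simp add: D_def)
  ultimately show ?thesis by blast
qed

section \<open>Lowering the exponent, and dyadic sums\<close>

text \<open>Taking n-th roots gives \<open>m powr ((n - 1) / n) \<le> C * s\<close>. Multiplying by
  a power of \<open>m \<le> V\<close> raises the exponent to \<open>1 / q\<close>; the missing
  exponent \<delta> is non-negative exactly because \<open>q \<le> n / (n - 1)\<close>.\<close>

lemma powr_le_of_power_le:
  fixes m s V C q :: real
  assumes "0 \<le> m" "m \<le> V" "0 \<le> s" "0 \<le> C" "2 \<le> n" "1 \<le> q" "q \<le> n / (real n - 1)"
    and le: "m ^ (n - 1) \<le> (C * s) ^ n"
  shows "m \<le> (C * V powr (1 / q - (real n - 1) / n) * s) powr q"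
proof (cases "m = 0")
  case False
  then have m: "m > 0" using assms by simp
  define \<delta> where "\<delta> = 1 / q - (real n - 1) / n"
  have \<delta>: "\<delta> \<ge> 0" using assms by (simp add: \<delta>_def field_simps)
  have "(m powr ((real n - 1) / n)) ^ n = m powr (((real n - 1) / n) * n)"
    using m by (simp add: powr_powr flip: powr_realpow)
  also have "((real n - 1) / n) * n = real (n - 1)" using assms by (simp add: of_nat_diff)
  also have "m powr real (n - 1) = m ^ (n - 1)" using m by (simp add: powr_realpow)
  finally have "(m powr ((real n - 1) / n)) ^ n \<le> (C * s) ^ n" using le by simp
  then have "m powr ((real n - 1) / n) \<le> C * s"
    using assms by (subst (asm) power_mono_iff) auto
  moreover have "m powr \<delta> \<le> V powr \<delta>" using \<delta> assms by (intro powr_mono2) auto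
  ultimately have "m powr ((real n - 1) / n) * m powr \<delta> \<le> C * s * V powr \<delta>"
    using assms by (intro mult_mono) auto
  also have "m powr ((real n - 1) / n) * m powr \<delta> = m powr (1 / q)"
    by (simp add: \<delta>_def flip: powr_add)
  finally have "(m powr (1 / q)) powr q \<le> (C * s * V powr \<delta>) powr q"
    using assms by (intro powr_mono2) auto
  then show ?thesis using m assms by (simp add: powr_powr \<delta>_def mult_ac)
qed simp

lemma powr_diff_one_mult: "0 \<le> x \<Longrightarrow> x powr (q - 1) * x = x powr (q::real)" for x :: real
  by (cases "x = 0") (auto simp: powr_diff)

text \<open>The halving makes the geometric sum fit: if the top level \<open>J * 2 ^ m\<close> is
  below \<open>v\<close>, all terms up to it add up to \<open>J * 2 ^ m - J / 2\<close>. Otherwise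
  the last term is 0.\<close>

lemma dyadic_partial_sum_le:
  fixes J v :: real
  assumes "J > 0" "v \<ge> 0"
  shows "(\<Sum>j<m. if J * 2 ^ j < v then J * 2 ^ j / 2 else 0) \<le> v"
proof (induction m)
  case (Suc m)
  show ?case
  proof (cases "J * 2 ^ m < v")
    case True
    have "(\<Sum>j<Suc m. if J * 2 ^ j < v then J * 2 ^ j / 2 else 0) \<le> (\<Sum>j<Suc m. J / 2 * 2 ^ j)"
      using assms by (intro sum_mono) auto
    also have "\<dots> = J / 2 * (2 ^ Suc m - 1)"
      by (induction m) (simp_all add: algebra_simps)
    also have "\<dots> \<le> v" using True assms by (simp add: algebra_simps)
    finally show ?thesis .
  next
    case False
    then show ?thesis using Suc by simp
  qed
qed (use assms in simp)

lemma dyadic_sum_le: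
  fixes y :: ennreal
  assumes "J > 0"
  shows "(\<Sum>j. ennreal (J * 2 ^ j / 2) * of_bool (ennreal (J * 2 ^ j) < y)) \<le> y"
proof (cases y)
  case (real v)
  have "(\<Sum>j<m. ennreal (J * 2 ^ j / 2) * of_bool (ennreal (J * 2 ^ j) < y)) \<le> y" for m
  proof -
    have "(\<Sum>j<m. ennreal (J * 2 ^ j / 2) * of_bool (ennreal (J * 2 ^ j) < y))
        = (\<Sum>j<m. ennreal (if J * 2 ^ j < v then J * 2 ^ j / 2 else 0))"
      using real assms by (intro sum.cong) (auto simp: ennreal_less_iff)
    also have "\<dots> = ennreal (\<Sum>j<m. if J * 2 ^ j < v then J * 2 ^ j / 2 else 0)"
      using assms by (intro sum_ennreal) auto
    also have "\<dots> \<le> y"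
      using dyadic_partial_sum_le[OF assms real(1), of m] real by (simp add: ennreal_leI)
    finally show ?thesis .
  qed
  then show ?thesis by (intro suminf_le_const) auto
qed simp

text \<open>For finite \<open>y > J\<close> a single term suffices: the last level below
  \<open>y\<close> is at least \<open>y / 2\<close>. For infinite \<open>y\<close> every term is at
  least \<open>(2 * J) powr q\<close>, so the series diverges.\<close>

lemma enn_powr_le_dyadic_sum:
  fixes y :: ennreal
  assumes J: "J > 0" and q: "q \<ge> 0"
  shows "enn_powr y q \<le> ennreal (J powr q)
    + (\<Sum>j. ennreal ((2 * (J * 2 ^ j)) powr q) * of_bool (ennreal (J * 2 ^ j) < y))"
proof (cases y)
  case (real v)
  show ?thesis
  proof (cases "v \<le> J")
    case True
    then have "enn_powr y q \<le> ennreal (J powr q)"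
      using real q by (simp add: enn_powr_def powr_mono2 ennreal_leI)
    then show ?thesis by (simp add: add_increasing2)
  next
    case False
    obtain k where "v / J < 2 ^ k" using real_arch_pow[of 2 "v / J"] by auto
    then have ex: "v \<le> J * 2 ^ k" using J by (simp add: field_simps)
    \<comment> \<open>The first level not below \<open>v\<close>. As \<open>v > J\<close>, it is not
      level 0, and its predecessor \<open>j\<close> is the last level below
      \<open>v\<close>.\<close>
    define l where "l = (LEAST k. v \<le> J * 2 ^ k)"
    have l: "v \<le> J * 2 ^ l" unfolding l_def using ex by (rule LeastI)
    then obtain j where j: "l = Suc j" using False by (cases l) auto
    have jv: "J * 2 ^ j < v" using not_less_Least[of j "\<lambda>k. v \<le> J * 2 ^ k"] j l_def by simp
    define f where "f j = ennreal ((2 * (J * 2 ^ j)) powr q) * of_bool (ennreal (J * 2 ^ j) < y)" for j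
    have "enn_powr y q = ennreal (v powr q)" using real by (simp add: enn_powr_def)
    also have "\<dots> \<le> ennreal ((2 * (J * 2 ^ j)) powr q)"
      using l j real q by (intro ennreal_leI powr_mono2) (auto simp: mult_ac)
    also have "\<dots> = (\<Sum>j\<in>{j}. f j)" using jv real J by (simp add: f_def ennreal_less_iff)
    also have "\<dots> \<le> (\<Sum>j. f j)" by (intro sum_le_suminf) auto
    finally show ?thesis unfolding f_def by (simp add: add_increasing)
  qed
next
  case top
  have "(\<Sum>j. ennreal ((2 * J) powr q)) = (\<integral>\<^sup>+ j. ennreal ((2 * J) powr q) \<partial>count_space (UNIV :: nat set))"
    by (rule nn_integral_count_space_nat[symmetric])
  also have "\<dots> = top" using J by (simp add: ennreal_mult_eq_top_iff)
  finally have "top = (\<Sum>j. ennreal ((2 * J) powr q))" by simp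
  also have "\<dots> \<le> (\<Sum>j. ennreal ((2 * (J * 2 ^ j)) powr q) * of_bool (ennreal (J * 2 ^ j) < y))"
    using J q top by (intro suminf_le ennreal_leI powr_mono2) (auto intro!: ennreal_leI powr_mono2)
  finally show ?thesis by (simp add: top_unique)
qed

section \<open>Summation over the levels and the final constant\<close>

lemma convex_sublevel_ennreal:
  assumes "convex_on_ennreal P u" "convex P"
  shows "convex {x \<in> P. u x \<le> c}"
proof (intro convexI CollectI conjI)
  fix x y and v t :: real
  assume *: "x \<in> {x \<in> P. u x \<le> c}" "y \<in> {x \<in> P. u x \<le> c}" "0 \<le> v" "0 \<le> t" "v + t = 1"
  then show "v *\<^sub>R x + t *\<^sub>R y \<in> P" using \<open>convex P\<close> by (auto intro: convexD)
  have v: "v = 1 - t" using * by simp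
  have "u (v *\<^sub>R x + t *\<^sub>R y) \<le> ennreal v * u x + ennreal t * u y"
    using assms(1) * unfolding convex_on_ennreal_def v by auto
  also have "\<dots> \<le> ennreal v * c + ennreal t * c"
    using * by (intro add_mono mult_left_mono) auto
  also have "\<dots> = c"
    using * by (simp flip: distrib_right ennreal_plus)
  finally show "u (v *\<^sub>R x + t *\<^sub>R y) \<le> c" .
qed

text \<open>Since \<open>u\<close> need not be Borel measurable on \<open>P\<close>, its sublevel sets \<open>K\<close> are replaced by
  \<open>interior K\<close> in the upper bound for the volume integral and by \<open>closure K\<close> in the lower bound
  for the boundary integral.\<close>

lemma enn_powr_integral_le:
  fixes P :: "'a::euclidean_space set" and u :: "'a \<Rightarrow> ennreal"
  assumes P: "compact P" "convex P"
    and \<mu>: "sets \<mu> = sets borel" "c > 0" "\<And>A. A \<in> sets borel \<Longrightarrow> emeasure \<mu> A = ennreal c * emeasure lborel (A \<inter> P)"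
    and \<sigma>: "sets \<sigma> = sets borel"
    and C: "C \<ge> 0" "\<And>K. closed K \<Longrightarrow> convex K \<Longrightarrow> K \<subseteq> P \<Longrightarrow>
      emeasure lborel (P - K) ^ (DIM('a) - 1) \<le> (ennreal C * emeasure \<sigma> (frontier P - K)) ^ DIM('a)"
    and q: "2 \<le> DIM('a)" "1 \<le> q" "q \<le> real DIM('a) / (real DIM('a) - 1)"
    and D_def: "D = C * measure lborel P powr (1 / q - (real DIM('a) - 1) / real DIM('a))"
    and u: "convex_on_ennreal P u"
    and J: "J > 0" "(\<integral>\<^sup>+ x. u x * indicator (frontier P) x \<partial>\<sigma>) \<le> ennreal J"
  shows "(\<integral>\<^sup>+ x. enn_powr (u x) q * indicator P x \<partial>\<mu>)
    \<le> ennreal ((c * measure lborel P + 2 powr (q + 1) * c * D * (2 * D) powr (q - 1)) * J powr q)"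
proof -
  define t where "t j = J * 2 ^ j" for j :: nat
  define K where "K j = {x \<in> P. u x \<le> ennreal (t j)}" for j
  define s where "s j = emeasure \<sigma> (frontier P - closure (K j))" for j
  have t: "t j > 0" for j using J by (simp add: t_def)
  have closedP: "closed P" using P(1) by (rule compact_imp_closed)
  have [measurable]: "P \<in> sets borel" using closedP by auto
  have convK: "convex (K j)" for j unfolding K_def by (rule convex_sublevel_ennreal[OF u P(2)])
  have clK: "closure (K j) \<subseteq> P" for j
    using closedP by (intro closure_minimal) (auto simp: K_def)
  have outside: "ennreal (t j) < u x" if "x \<in> P" "x \<notin> closure (K j)" for x j
    using that closure_subset[of "K j"] by (force simp: K_def not_le)
  have inside: "u x \<le> ennreal (t j)" if "x \<in> interior (K j)" for x j
    using that interior_subset[of "K j"] by (auto simp: K_def)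
  have D: "D \<ge> 0" using C by (simp add: D_def)
  have finP: "emeasure lborel P < \<infinity>" using P(1) by (intro emeasure_bounded_finite compact_imp_bounded)
  have volP: "emeasure \<mu> P = ennreal (c * measure lborel P)"
    using \<mu>(2,3) finP by (simp add: ennreal_mult emeasure_eq_ennreal_measure)
  have [measurable]: "frontier P - closure (K j) \<in> sets \<sigma>" for j
    unfolding \<sigma> by (intro sets.Diff borel_closed) auto
  have [measurable]: "P - interior (K j) \<in> sets \<mu>" "P \<in> sets \<mu>" for j
    unfolding \<mu>(1) by auto
  \<comment> \<open>The sets \<open>frontier P - closure (K j)\<close> are Borel and
    \<open>u\<close> exceeds \<open>t j\<close> on them, so the weighted sum of their indicators is
    a Borel minorant of \<open>u\<close> on the frontier.\<close>
  have sum_s: "(\<Sum>j. ennreal (t j / 2) * s j) \<le> ennreal J"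
  proof -
    have "(\<Sum>j. ennreal (t j / 2) * s j)
        = (\<integral>\<^sup>+ x. (\<Sum>j. ennreal (t j / 2) * indicator (frontier P - closure (K j)) x) \<partial>\<sigma>)"
      unfolding s_def
      by (subst nn_integral_suminf, measurable, simp add: nn_integral_cmult_indicator)
    also have "\<dots> \<le> (\<integral>\<^sup>+ x. u x * indicator (frontier P) x \<partial>\<sigma>)"
    proof (rule nn_integral_mono)
      fix x
      show "(\<Sum>j. ennreal (t j / 2) * indicator (frontier P - closure (K j)) x) \<le> u x * indicator (frontier P) x"
      proof (cases "x \<in> frontier P")
        case True
        then have "x \<in> P" using closedP by (auto simp: frontier_def)
        then have "(\<Sum>j. ennreal (t j / 2) * indicator (frontier P - closure (K j)) x)
            \<le> (\<Sum>j. ennreal (t j / 2) * of_bool (ennreal (t j) < u x))"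
          using outside by (intro suminf_le mult_left_mono) (auto simp: indicator_def)
        also have "\<dots> \<le> u x" unfolding t_def by (rule dyadic_sum_le[OF J(1)])
        finally show ?thesis using True by simp
      qed simp
    qed
    finally show ?thesis using J(2) by simp
  qed
  \<comment> \<open>The Chebyshev bound, read off as one term of the sum. The weight
    \<open>t j / 2\<close> is why \<open>2 * J\<close> appears in the estimates below.\<close>
  have s_le: "ennreal (t j / 2) * s j \<le> ennreal J" for j
  proof -
    have "(\<Sum>j\<in>{j}. ennreal (t j / 2) * s j) \<le> (\<Sum>j. ennreal (t j / 2) * s j)"
      by (intro sum_le_suminf) auto
    then show ?thesis using sum_s by simp
  qed
  \<comment> \<open>Write \<open>(2 * t * D * s) powr q\<close> as
    \<open>2 powr q * (D * t * s) powr (q - 1) * (D * t * s)\<close>. In the middle factor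
    \<open>t * s \<le> 2 * J\<close>; the last keeps \<open>t * s = 2 * (t / 2 * s)\<close>, which
    is summable and yields the extra 2 in \<open>2 powr (q + 1)\<close>. The factor \<open>c\<close>
    converts Lebesgue measure to \<mu>.\<close>
  define E where "E = 2 powr (q + 1) * c * D * (2 * D * J) powr (q - 1)"
  have E: "E \<ge> 0" using D \<mu>(2) by (simp add: E_def)
  have vol_le: "ennreal ((2 * t j) powr q) * emeasure \<mu> (P - interior (K j)) \<le> ennreal E * (ennreal (t j / 2) * s j)" for j
  proof -
    have "s j \<noteq> top"
    proof
      assume "s j = top"
      then show False using s_le[of j] t[of j] by (simp add: ennreal_mult_top top_unique)
    qed
    then obtain r where r: "s j = ennreal r" "r \<ge> 0" by (cases "s j") auto
    define m where "m = measure lborel (P - closure (K j))"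
    have mfin: "emeasure lborel (P - closure (K j)) = ennreal m"
      unfolding m_def
    proof (rule emeasure_eq_ennreal_measure)
      have "bounded (P - closure (K j))"
        using P(1) by (meson Diff_subset bounded_subset compact_imp_bounded)
      then show "emeasure lborel (P - closure (K j)) \<noteq> top"
        using emeasure_bounded_finite by force
    qed
    have m0: "m \<ge> 0" by (simp add: m_def)
    have mV: "m \<le> measure lborel P"
      unfolding m_def using finP by (intro measure_mono_fmeasurable) (auto intro: fmeasurableI)
    have "ennreal m ^ (DIM('a) - 1) \<le> (ennreal C * ennreal r) ^ DIM('a)"
      using C(2)[of "closure (K j)"] convK clK by (simp add: mfin r(1)[symmetric] s_def convex_closure)
    then have "m ^ (DIM('a) - 1) \<le> (C * r) ^ DIM('a)"
      using m0 C(1) r(2) by (simp add: ennreal_power flip: ennreal_mult)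
    then have "m \<le> (D * r) powr q"
      unfolding D_def using q m0 mV C(1) r(2) by (intro powr_le_of_power_le) auto
    then have "(2 * t j) powr q * m \<le> (2 * t j) powr q * (D * r) powr q"
      by (intro mult_left_mono) auto
    also have "\<dots> = (2 * t j * (D * r)) powr q"
      using t[of j] D r(2) by (subst powr_mult) auto
    also have "\<dots> = 2 powr q * (D * (t j * r)) powr q"
      using t[of j] D r(2) by (subst powr_mult[symmetric]) (auto simp: mult_ac)
    also have "(D * (t j * r)) powr q = (D * (t j * r)) powr (q - 1) * (D * (t j * r))"
      using t[of j] D r(2) by (subst powr_diff_one_mult) auto
    also have "(D * (t j * r)) powr (q - 1) \<le> (2 * D * J) powr (q - 1)"
    proof -
      have "t j / 2 * r \<le> J"
        using s_le[of j] t[of j] r J(1) by (simp flip: ennreal_mult)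
      then have "t j * r \<le> 2 * J" by simp
      then have "D * (t j * r) \<le> D * (2 * J)" using D by (rule mult_left_mono)
      then show ?thesis using D t[of j] r(2) q by (intro powr_mono2) auto
    qed
    finally have "(2 * t j) powr q * m \<le> 2 powr q * ((2 * D * J) powr (q - 1) * (D * (t j * r)))"
      using D t[of j] r(2) by (simp add: mult_right_mono)
    then have "c * ((2 * t j) powr q * m) \<le> c * (2 powr q * ((2 * D * J) powr (q - 1) * (D * (t j * r))))"
      using \<mu>(2) by simp
    also have "\<dots> = E * (t j / 2 * r)"
      by (simp add: E_def powr_add)
    finally have le: "(2 * t j) powr q * (c * m) \<le> E * (t j / 2 * r)" by (simp add: mult_ac)
    have "emeasure \<mu> (P - interior (K j)) = ennreal c * emeasure lborel (P - interior (K j))"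
      using \<mu>(3)[of "P - interior (K j)"] by (simp add: Int_absorb2 Diff_subset)
    also have "\<dots> = ennreal (c * m)"
      using \<mu>(2) m0 by (simp add: emeasure_lborel_convex_complement[OF convK] mfin ennreal_mult)
    finally have "ennreal ((2 * t j) powr q) * emeasure \<mu> (P - interior (K j)) = ennreal ((2 * t j) powr q * (c * m))"
      using \<mu>(2) m0 by (simp add: ennreal_mult)
    also have "\<dots> \<le> ennreal (E * (t j / 2 * r))" using le by (rule ennreal_leI)
    also have "\<dots> = ennreal E * (ennreal (t j / 2) * s j)"
      using E t[of j] r by (simp flip: ennreal_mult)
    finally show ?thesis .
  qed
  \<comment> \<open>Here the comparison runs the other way: \<open>P - interior (K j)\<close> is
    Borel and contains all points of \<open>P\<close> where \<open>u\<close> exceeds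
    \<open>t j\<close>, which gives a Borel majorant.\<close>
  have "(\<integral>\<^sup>+ x. enn_powr (u x) q * indicator P x \<partial>\<mu>)
      \<le> (\<integral>\<^sup>+ x. ennreal (J powr q) * indicator P x
            + (\<Sum>j. ennreal ((2 * t j) powr q) * indicator (P - interior (K j)) x) \<partial>\<mu>)"
  proof (rule nn_integral_mono)
    fix x
    show "enn_powr (u x) q * indicator P x \<le> ennreal (J powr q) * indicator P x
            + (\<Sum>j. ennreal ((2 * t j) powr q) * indicator (P - interior (K j)) x)"
    proof (cases "x \<in> P")
      case True
      have "enn_powr (u x) q \<le> ennreal (J powr q)
          + (\<Sum>j. ennreal ((2 * t j) powr q) * of_bool (ennreal (t j) < u x))"
        unfolding t_def using q by (intro enn_powr_le_dyadic_sum J(1)) simp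
      also have "(\<Sum>j. ennreal ((2 * t j) powr q) * of_bool (ennreal (t j) < u x))
          \<le> (\<Sum>j. ennreal ((2 * t j) powr q) * indicator (P - interior (K j)) x)"
        using True inside by (intro suminf_le mult_left_mono) (auto simp: indicator_def not_less[symmetric])
      finally show ?thesis using True by (simp add: add_left_mono)
    qed simp
  qed
  also have "\<dots> = ennreal (J powr q) * emeasure \<mu> P + (\<Sum>j. ennreal ((2 * t j) powr q) * emeasure \<mu> (P - interior (K j)))"
    by (subst nn_integral_add, measurable, subst nn_integral_suminf, measurable,
        simp add: nn_integral_cmult_indicator)
  also have "(\<Sum>j. ennreal ((2 * t j) powr q) * emeasure \<mu> (P - interior (K j))) \<le> (\<Sum>j. ennreal E * (ennreal (t j / 2) * s j))"
    using vol_le by (intro suminf_le) auto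
  also have "\<dots> = ennreal E * (\<Sum>j. ennreal (t j / 2) * s j)" by (rule ennreal_suminf_cmult)
  also have "\<dots> \<le> ennreal E * ennreal J" using sum_s by (rule mult_left_mono) simp
  also have "ennreal (J powr q) * emeasure \<mu> P + ennreal E * ennreal J = ennreal (J powr q * (c * measure lborel P) + E * J)"
    using E J(1) \<mu>(2) by (simp add: volP ennreal_mult)
  \<comment> \<open>\<open>E\<close> carries \<open>J powr (q - 1)\<close>, so both terms are
    homogeneous of degree \<open>q\<close> in \<open>J\<close>.\<close>
  also have "J powr q * (c * measure lborel P) + E * J
      = (c * measure lborel P + 2 powr (q + 1) * c * D * (2 * D) powr (q - 1)) * J powr q"
  proof -
    have "(2 * D * J) powr (q - 1) * J = (2 * D) powr (q - 1) * J powr q"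
      using D J(1) powr_diff_one_mult[of J q] by (simp add: powr_mult mult.assoc)
    then show ?thesis by (simp add: E_def algebra_simps)
  qed
  finally show ?thesis by (simp add: add_left_mono)
qed

theorem mainTheorem8:
  fixes P :: "'a::euclidean_space set" and \<mu> \<sigma> :: "'a measure" and q :: real
  assumes "n_system P \<mu> \<sigma>"
    and "DIM('a) \<ge> 2"
    and "1 \<le> q" and "q \<le> real DIM('a) / (real DIM('a) - 1)"
  shows "\<exists>C::real. C > 0 \<and>
    (\<forall>u :: 'a \<Rightarrow> ennreal. convex_on_ennreal P u \<longrightarrow>
       enn_powr (\<integral>\<^sup>+ x. enn_powr (u x) q * indicator P x \<partial>\<mu>) (1 / q)
         \<le> ennreal C * (\<integral>\<^sup>+ x. u x * indicator (frontier P) x \<partial>\<sigma>))"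
proof -
  have P: "polyhedron P" "compact P" "interior P \<noteq> {}"
    and \<sigma>: "boundary_measure_on P \<sigma>"
    using assms(1) by (auto simp: n_system_def simple_polytope_def)
  have "sets \<mu> = sets borel \<and> (\<exists>c::real. c > 0 \<and> (\<forall>A \<in> sets borel. emeasure \<mu> A = ennreal c * emeasure lborel (A \<inter> P)))"
    using assms(1) by (simp add: n_system_def volume_measure_on_def)
  then obtain c where \<mu>: "sets \<mu> = sets borel" "c > 0"
    "\<And>A. A \<in> sets borel \<Longrightarrow> emeasure \<mu> A = ennreal c * emeasure lborel (A \<inter> P)"
    by (elim conjE exE) simp
  obtain C where C: "C \<ge> 0" "\<And>K. closed K \<Longrightarrow> convex K \<Longrightarrow> K \<subseteq> P \<Longrightarrow>
      emeasure lborel (P - K) ^ (DIM('a) - 1) \<le> (ennreal C * emeasure \<sigma> (frontier P - K)) ^ DIM('a)"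
    using volume_complement_convex_le[OF P \<sigma> assms(2)] by (elim exE conjE) simp
  define D where "D = C * measure lborel P powr (1 / q - (real DIM('a) - 1) / real DIM('a))"
  define B where "B = c * measure lborel P + 2 powr (q + 1) * c * D * (2 * D) powr (q - 1)"
  have B: "B \<ge> 0" using C(1) \<mu>(2) by (simp add: B_def D_def)
  \<comment> \<open>Adding 1 makes \<open>G\<close> positive from \<open>B \<ge> 0\<close> alone.
    Positivity also settles the case of an infinite boundary integral and allows the division by
    \<open>G\<close> below.\<close>
  define G where "G = (B + 1) powr (1 / q)"
  have G: "G > 0" using B by (simp add: G_def)
  show ?thesis
  proof (intro exI[of _ G] conjI allI impI G)
    fix u :: "'a \<Rightarrow> ennreal" assume u: "convex_on_ennreal P u"
    define I where "I = (\<integral>\<^sup>+ x. u x * indicator (frontier P) x \<partial>\<sigma>)"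
    define L where "L = (\<integral>\<^sup>+ x. enn_powr (u x) q * indicator P x \<partial>\<mu>)"
    have bound: "enn_powr L (1 / q) \<le> ennreal (G * J)" if J: "J > 0" "I \<le> ennreal J" for J
    proof -
      have le: "L \<le> ennreal (B * J powr q)"
        unfolding L_def B_def
        by (rule enn_powr_integral_le[OF P(2) polyhedron_imp_convex[OF P(1)] \<mu> _ C assms(2-4) D_def u J(1)])
          (use \<sigma> J(2) in \<open>auto simp: boundary_measure_on_def I_def\<close>)
      then obtain l where l: "L = ennreal l" "l \<ge> 0"
        by (cases L) (auto simp: top_unique)
      then have "l \<le> B * J powr q" using le B by simp
      also have "\<dots> \<le> (B + 1) * J powr q" by (simp add: algebra_simps)
      finally have "l powr (1 / q) \<le> ((B + 1) * J powr q) powr (1 / q)"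
        using l(2) assms(3) by (intro powr_mono2) auto
      also have "\<dots> = G * J"
        using B J(1) assms(3) by (simp add: G_def powr_mult powr_powr)
      finally show ?thesis using l by (simp add: enn_powr_def ennreal_leI)
    qed
    have "enn_powr L (1 / q) \<le> ennreal G * I"
    proof (cases I)
      case (real i)
      show ?thesis
      \<comment> \<open>The choice \<open>J = i + e / G\<close> is positive even when the boundary
        integral is 0, and its excess over \<open>i\<close> costs exactly \<open>e\<close>.\<close>
      proof (rule ennreal_le_epsilon)
        fix e :: real assume e: "0 < e"
        have "enn_powr L (1 / q) \<le> ennreal (G * (i + e / G))"
          using e G real by (intro bound) (auto intro!: add_nonneg_pos ennreal_leI)
        also have "G * (i + e / G) = G * i + e" using G by (simp add: distrib_left)
        also have "ennreal (G * i + e) = ennreal G * I + ennreal e"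
          using real e G by (simp add: ennreal_mult)
        finally show "enn_powr L (1 / q) \<le> ennreal G * I + ennreal e" .
      qed
    next
      case top
      then show ?thesis using G by (simp add: ennreal_mult_top)
    qed
    then show "enn_powr (\<integral>\<^sup>+ x. enn_powr (u x) q * indicator P x \<partial>\<mu>) (1 / q)
         \<le> ennreal G * (\<integral>\<^sup>+ x. u x * indicator (frontier P) x \<partial>\<sigma>)"
      by (simp add: L_def I_def)
  qed
qed

end
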